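(* For every integer $r\ge 3$, $\mu_{\rm t}(K_s^{\square, r}) = \Theta(s^{r-2})$ as $s\to\infty$.
   Context: For a connected graph $G$ and $X\subseteq V(G)$, two vertices $x,y$ are $X$-visible if there is a shortest $x,y$-path none of whose internal vertices lies in $X$. $X$ is a total mutual-visibility set if every two vertices of $V(G)$ are $X$-visible. $\mu_{\rm t}(G)$ is the maximum cardinality of a total mutual-visibility set of $G$. $K_s^{\square, r}$ is the Cartesian product of $r$ copies of the complete graph $K_s$ (vertices are $r$-tuples over $[s]$, adjacent iff they differ in exactly one coordinate). *)

theory Defs
  imports
    "Graph_Theory.Graph_Theory"
    "HOL-Library.FuncSet"
    "HOL-Library.Landau_Symbols"
begin

text \<open>
  A simple graph is a symmetric, loop-free digraph, each edge being a pair of opposite arcs; paths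
  are the vertex lists described by \<^const>\<open>vpath\<close>. The visibility notions below are meant for
  finite connected graphs.
\<close>

definition shortest_vpath :: "('a, 'b) pre_digraph \<Rightarrow> 'a \<Rightarrow> 'a list \<Rightarrow> 'a \<Rightarrow> bool" where
  "shortest_vpath G x p y \<longleftrightarrow>
     vpath p G \<and> hd p = x \<and> last p = y \<and>
     (\<forall>q. vpath q G \<and> hd q = x \<and> last q = y \<longrightarrow> vwalk_length p \<le> vwalk_length q)"

text \<open>
  The list \<open>butlast (tl p)\<close> consists of the internal vertices of \<open>p\<close>; it is empty if \<open>p\<close> has at most
  two vertices. In particular a vertex is visible from itself.
\<close>

definition visible :: "('a, 'b) pre_digraph \<Rightarrow> 'a set \<Rightarrow> 'a \<Rightarrow> 'a \<Rightarrow> bool" where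
  "visible G X x y \<longleftrightarrow> (\<exists>p. shortest_vpath G x p y \<and> set (butlast (tl p)) \<inter> X = {})"

definition total_mutual_visibility_set :: "('a, 'b) pre_digraph \<Rightarrow> 'a set \<Rightarrow> bool" where
  "total_mutual_visibility_set G X \<longleftrightarrow>
     X \<subseteq> verts G \<and> (\<forall>x \<in> verts G. \<forall>y \<in> verts G. visible G X x y)"

definition mu_t :: "('a, 'b) pre_digraph \<Rightarrow> nat" where
  "mu_t G = Max {card X | X. total_mutual_visibility_set G X}"

text \<open>
  The Cartesian power of a complete graph; \<open>r\<close>-tuples are extensional functions on \<open>{1..r}\<close>.
\<close>

definition complete_power :: "nat \<Rightarrow> nat \<Rightarrow> (nat \<Rightarrow> nat) pair_pre_digraph" where
  "complete_power s r =
     \<lparr> pverts = {1..r} \<rightarrow>\<^sub>E {1..s},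
       parcs = {(u, v). u \<in> {1..r} \<rightarrow>\<^sub>E {1..s} \<and> v \<in> {1..r} \<rightarrow>\<^sub>E {1..s} \<and>
                        (\<exists>!i. i \<in> {1..r} \<and> u i \<noteq> v i)} \<rparr>"

lemma pair_graph_complete_power: "pair_graph (complete_power s r)"
proof -
  let ?V = "{1..r} \<rightarrow>\<^sub>E {1..s}"
  have fin: "finite ?V" by (simp add: finite_PiE)
  have "parcs (complete_power s r) \<subseteq> ?V \<times> ?V"
    by (auto simp: complete_power_def)
  then have fin': "finite (parcs (complete_power s r))"
    by (rule finite_subset) (intro finite_cartesian_product fin)
  have "sym (parcs (complete_power s r))"
  proof (rule symI)
    fix u v assume "(u, v) \<in> parcs (complete_power s r)"
    then have "u \<in> ?V" "v \<in> ?V" "\<exists>!i. i \<in> {1..r} \<and> u i \<noteq> v i"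
      unfolding complete_power_def by simp_all
    moreover have "(\<lambda>i. i \<in> {1..r} \<and> u i \<noteq> v i) = (\<lambda>i. i \<in> {1..r} \<and> v i \<noteq> u i)"
      by (rule ext) (metis (lifting))
    ultimately show "(v, u) \<in> parcs (complete_power s r)"
      unfolding complete_power_def by simp
  qed
  then have "symmetric (with_proj (complete_power s r))"
    by (simp add: symmetric_def)
  moreover have "fst e \<in> ?V" "snd e \<in> ?V" "fst e \<noteq> snd e"
    if "e \<in> parcs (complete_power s r)" for e
    using that by (cases e; force simp: complete_power_def)+
  moreover have "pverts (complete_power s r) = ?V"
    by (simp add: complete_power_def)
  ultimately show ?thesis
    using fin fin' by unfold_locales simp_all
qed

lemma connected_complete_power:
  assumes "s \<ge> 1"
  shows "Digraph_Component.connected (with_proj (complete_power s r))"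
proof -
  let ?V = "{1..r} \<rightarrow>\<^sub>E {1..s}" and ?E = "(parcs (complete_power s r))\<^sup>s"
  have reach: "(u, v) \<in> rtrancl_on ?V ?E" if "u \<in> ?V" "v \<in> ?V" for u v
    using that
  proof (induction "card {i \<in> {1..r}. u i \<noteq> v i}" arbitrary: u)
    case 0
    then have "u = v" by (intro PiE_ext) auto
    with 0 show ?case by simp
  next
    case (Suc n)
    let ?D = "\<lambda>u. {i \<in> {1..r}. u i \<noteq> v i}"
    from Suc(2) obtain i where i: "i \<in> ?D u"
      by (metis card.empty equals0I nat.distinct(1))
    define w where "w = u(i := v i)"
    have w: "w \<in> ?V"
      using Suc.prems i unfolding w_def by (auto simp: PiE_iff extensional_def)
    have "?D w = ?D u - {i}" by (auto simp: w_def)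
    then have "n = card (?D w)" using Suc(2) i by simp
    then have wv: "(w, v) \<in> rtrancl_on ?V ?E" using Suc(1) w Suc.prems by blast
    have uw: "(u, w) \<in> ?E"
    proof -
      have "\<exists>!j. j \<in> {1..r} \<and> u j \<noteq> w j"
        by (rule ex1I[of _ i]) (use i in \<open>auto simp: w_def split: if_splits\<close>)
      then have "(u, w) \<in> parcs (complete_power s r)"
        using Suc.prems(1) w by (simp add: complete_power_def)
      then show ?thesis by (simp add: symcl_def)
    qed
    show ?case
      by (rule converse_rtrancl_on_into_rtrancl_on[OF uw wv Suc.prems(1)])
  qed
  have ne: "?V \<noteq> {}"
    using assms by (subst PiE_eq_empty_iff) auto
  have V: "pverts (complete_power s r) = ?V" by (simp add: complete_power_def)
  show ?thesis
    unfolding connected_conv with_proj_simps V using ne reach by blast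
qed

end

theory Submission
  imports Defs
begin

text \<open>
  A set \<open>X\<close> of vertices of the Hamming graph is a total mutual-visibility set iff it contains no two
  vertices at Hamming distance exactly 2: such a pair consists of all common neighbours of two
  further vertices, and conversely, if there is no such pair, then at least one of any two steps
  leading closer to the target avoids \<open>X\<close>, so that a geodesic can be built greedily.

  For the upper bound, in such a set \<open>X\<close> all neighbours of a vertex within \<open>X\<close> differ from it in one
  and the same coordinate. The vertices for which this coordinate is \<open>i\<close> are told apart by any
  \<open>r - 2\<close> coordinates that include \<open>i\<close>, whence \<open>card X \<le> r * s ^ (r - 2)\<close>.

  For the lower bound, the values of \<open>\<Sum>k. x k\<close> and \<open>\<Sum>k. k * x k\<close> together cannot both agree on
  two vertices at distance 2. There are \<open>O(s\<^sup>2)\<close> pairs of values, so some class of vertices with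
  equal values has size at least a constant times \<open>s ^ (r - 2)\<close>.
\<close>

section \<open>Hamming distance and the adjacency of the complete power\<close>

definition diff_set :: "nat \<Rightarrow> (nat \<Rightarrow> 'a) \<Rightarrow> (nat \<Rightarrow> 'a) \<Rightarrow> nat set" where
  "diff_set r u v = {i \<in> {1..r}. u i \<noteq> v i}"

lemma finite_diff_set [simp]: "finite (diff_set r u v)"
  by (simp add: diff_set_def)

lemma diff_set_commute: "diff_set r u v = diff_set r v u"
  by (auto simp: diff_set_def)

lemma diff_set_triangle: "card (diff_set r u w) \<le> card (diff_set r u v) + card (diff_set r v w)"
proof -
  have "card (diff_set r u w) \<le> card (diff_set r u v \<union> diff_set r v w)"
    by (rule card_mono) (auto simp: diff_set_def)
  also have "\<dots> \<le> card (diff_set r u v) + card (diff_set r v w)"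
    by (rule card_Un_le)
  finally show ?thesis .
qed

lemma diff_set_upd:
  assumes "i \<in> diff_set r u v"
  shows "diff_set r u (u(i := v i)) = {i}" "diff_set r (u(i := v i)) v = diff_set r u v - {i}"
  using assms by (auto simp: diff_set_def)

lemma diff_set_upd2:
  assumes "i \<in> diff_set r u v" "j \<in> diff_set r u v" "i \<noteq> j"
  shows "diff_set r (u(i := v i)) (u(j := v j)) = {i, j}"
  using assms by (auto simp: diff_set_def)

lemma diff_set_eq_empty:
  assumes "u \<in> {1..r} \<rightarrow>\<^sub>E A" "v \<in> {1..r} \<rightarrow>\<^sub>E A" "diff_set r u v = {}"
  shows "u = v"
  using assms by (intro PiE_ext[OF assms(1,2)]) (auto simp: diff_set_def)

lemma verts_complete_power [simp]: "pverts (complete_power s r) = {1..r} \<rightarrow>\<^sub>E {1..s}"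
  by (simp add: complete_power_def)

lemma arcs_complete_power:
  "(u, v) \<in> parcs (complete_power s r) \<longleftrightarrow>
     u \<in> {1..r} \<rightarrow>\<^sub>E {1..s} \<and> v \<in> {1..r} \<rightarrow>\<^sub>E {1..s} \<and> card (diff_set r u v) = 1"
proof -
  have "(\<exists>!i. i \<in> {1..r} \<and> u i \<noteq> v i) \<longleftrightarrow> card (diff_set r u v) = 1"
    unfolding card_1_singleton_iff One_nat_def diff_set_def by (auto simp: set_eq_iff) metis+
  then show ?thesis by (simp add: complete_power_def)
qed

lemma upd_in_PiE:
  assumes "u \<in> I \<rightarrow>\<^sub>E A" "v \<in> I \<rightarrow>\<^sub>E A" "i \<in> I"
  shows "u(i := v i) \<in> I \<rightarrow>\<^sub>E A"
  using assms by (auto simp: PiE_iff extensional_def)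

text \<open>Each arc changes a single coordinate, so the triangle inequality applies along the walk.
  This bound later certifies walks of length equal to the Hamming distance as shortest.\<close>

lemma vwalk_length_ge_distance:
  assumes "vwalk p (with_proj (complete_power s r))"
  shows "card (diff_set r (hd p) (last p)) \<le> vwalk_length p"
  using assms
proof (induction p rule: vwalk_induct)
  case (Base u)
  then show ?case by (simp add: diff_set_def)
next
  case (Cons u v es)
  then have "card (diff_set r u v) = 1" by (simp add: arcs_complete_power)
  with Cons.IH diff_set_triangle[of r u "last (v # es)" v] show ?case by simp
qed

section \<open>Characterization of total mutual-visibility sets\<close>

definition distance_two_free :: "nat \<Rightarrow> (nat \<Rightarrow> 'a) set \<Rightarrow> bool" where
  "distance_two_free r X \<longleftrightarrow> (\<forall>u\<in>X. \<forall>v\<in>X. card (diff_set r u v) \<noteq> 2)"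

text \<open>The bound on distances to \<open>y\<close> serves the induction: the vertex prepended is
  farther from \<open>y\<close> than every vertex of the tail, so the walk remains a path. The
  endpoints may lie in \<open>X\<close>.\<close>

lemma geodesic_avoiding:
  assumes "distance_two_free r X" "x \<in> {1..r} \<rightarrow>\<^sub>E {1..s}" "y \<in> {1..r} \<rightarrow>\<^sub>E {1..s}"
    and "card (diff_set r x y) = n"
  shows "\<exists>p. vpath p (with_proj (complete_power s r)) \<and> hd p = x \<and> last p = y \<and> length p = Suc n \<and>
           (\<forall>z\<in>set p. card (diff_set r z y) \<le> n) \<and> set (butlast (tl p)) \<inter> X = {}"
  using assms(2,4)
proof (induction n arbitrary: x)
  case 0
  then have "x = y" using diff_set_eq_empty[OF _ assms(3)] by simp
  then show ?case
    using assms(3) 0 by (intro exI[of _ "[x]"]) (auto simp: vpath_def vwalk_def)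
next
  case (Suc n)
  let ?D = "diff_set r x y"
  \<comment> \<open>For \<open>n = 0\<close> the corrected vertex is the endpoint \<open>y\<close>,
    which may lie in \<open>X\<close>. Otherwise correcting either of two coordinates gives vertices
    at distance 2 from each other, so one of them avoids \<open>X\<close>.\<close>
  obtain i where i: "i \<in> ?D" "n = 0 \<or> x(i := y i) \<notin> X"
  proof (cases "n = 0")
    case True
    from Suc.prems(2) have "?D \<noteq> {}" by auto
    then show ?thesis using that True by blast
  next
    case False
    with Suc.prems(2) have "Suc (Suc 0) \<le> card ?D" by simp
    then obtain i j where ij: "i \<in> ?D" "j \<in> ?D" "i \<noteq> j"
      using card_le_Suc0_iff_eq[of ?D] by (metis finite_diff_set not_less_eq_eq)
    then have "x(i := y i) \<notin> X \<or> x(j := y j) \<notin> X"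
      using assms(1) diff_set_upd2[OF ij] unfolding distance_two_free_def
      by (metis card_2_iff)
    then show ?thesis using that ij by blast
  qed
  define w where "w = x(i := y i)"
  have w: "w \<in> {1..r} \<rightarrow>\<^sub>E {1..s}"
    unfolding w_def using i(1) by (intro upd_in_PiE Suc.prems assms(3)) (simp add: diff_set_def)
  have "card (diff_set r w y) = n"
    using Suc.prems(2) i(1) unfolding w_def by (simp add: diff_set_upd)
  from Suc.IH[OF w this] obtain q where q: "vpath q (with_proj (complete_power s r))" "hd q = w"
    "last q = y" "length q = Suc n" "\<forall>z\<in>set q. card (diff_set r z y) \<le> n"
    "set (butlast (tl q)) \<inter> X = {}" by blast
  have xw: "(x, w) \<in> parcs (complete_power s r)"
    using Suc.prems w diff_set_upd(1)[OF i(1)] by (simp add: arcs_complete_power w_def)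
  have qne: "q \<noteq> []" using q(4) by auto
  have "x \<notin> set q" using q(5) Suc.prems(2) by fastforce
  then have "vpath (x # q) (with_proj (complete_power s r))"
    using q(1,2) xw Suc.prems(1) unfolding vpath_def by (auto intro: vwalk_consI)
  \<comment> \<open>These are the internal vertices of \<open>x # q\<close>: those of
    \<open>q\<close> together with \<open>w\<close>, unless \<open>q\<close> is a single
    vertex.\<close>
  moreover have "set (butlast q) \<inter> X = {}"
  proof (cases "n = 0")
    case True
    then have "butlast q = []" using q(4) by (cases q) auto
    then show ?thesis by simp
  next
    case False
    then obtain q' where "q = w # q'" "q' \<noteq> []" using q(2,4) by (cases q) auto
    then show ?thesis using q(6) i(2) False unfolding w_def by auto
  qed
  ultimately show ?case
    using q qne Suc.prems(2) by (intro exI[of _ "x # q"]) (auto simp: le_SucI)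
qed

lemma visible_if_distance_two_free:
  assumes "distance_two_free r X" "x \<in> {1..r} \<rightarrow>\<^sub>E {1..s}" "y \<in> {1..r} \<rightarrow>\<^sub>E {1..s}"
  shows "visible (with_proj (complete_power s r)) X x y"
proof -
  from geodesic_avoiding[OF assms refl] obtain p where
    p: "vpath p (with_proj (complete_power s r))" "hd p = x" "last p = y"
      "length p = Suc (card (diff_set r x y))" "set (butlast (tl p)) \<inter> X = {}" by blast
  have "vwalk_length p \<le> vwalk_length q"
    if "vpath q (with_proj (complete_power s r))" "hd q = x" "last q = y" for q
    using vwalk_length_ge_distance[of q s r] that p(4) by (auto simp: vpath_def)
  with p show ?thesis unfolding visible_def shortest_vpath_def by blast
qed

text \<open>If \<open>u\<close> and \<open>v\<close> differ in exactly two coordinates, they are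
  opposite corners of a 4-cycle. The other two corners \<open>x\<close> and \<open>y\<close> have
  only \<open>u\<close> and \<open>v\<close> as common neighbours, so \<open>X\<close> blocks every
  geodesic between them.\<close>

lemma distance_two_free_if_total:
  assumes "total_mutual_visibility_set (with_proj (complete_power s r)) X"
  shows "distance_two_free r X"
  unfolding distance_two_free_def
proof (intro ballI notI)
  fix u v assume uv: "u \<in> X" "v \<in> X" and "card (diff_set r u v) = 2"
  then obtain i j where ij: "diff_set r u v = {i, j}" "i \<noteq> j" by (auto simp: card_2_iff)
  let ?G = "with_proj (complete_power s r)"
  define x where "x = u(i := v i)"
  define y where "y = u(j := v j)"
  have V: "u \<in> {1..r} \<rightarrow>\<^sub>E {1..s}" "v \<in> {1..r} \<rightarrow>\<^sub>E {1..s}"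
    using assms uv unfolding total_mutual_visibility_set_def by auto
  have inr: "i \<in> {1..r}" "j \<in> {1..r}" using ij(1) unfolding diff_set_def by blast+
  have xy: "x \<in> {1..r} \<rightarrow>\<^sub>E {1..s}" "y \<in> {1..r} \<rightarrow>\<^sub>E {1..s}"
    unfolding x_def y_def using V inr by (simp_all only: upd_in_PiE)
  have dxy: "diff_set r x y = {i, j}" and dux: "diff_set r u x = {i}" and duy: "diff_set r u y = {j}"
    unfolding x_def y_def using ij by (simp_all add: diff_set_upd diff_set_upd2)
  from assms xy have "visible ?G X x y" by (simp add: total_mutual_visibility_set_def)
  then obtain p where p: "shortest_vpath ?G x p y" "set (butlast (tl p)) \<inter> X = {}"
    unfolding visible_def by blast
  \<comment> \<open>The detour through \<open>u\<close> has length 2, matching the Hamming lower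
    bound, so \<open>p\<close> has exactly one internal vertex.\<close>
  have "vpath [x, u, y] ?G"
    using V xy dux duy dxy ij(2) diff_set_commute[of r u x]
    by (auto simp: vpath_def vwalk_def arcs_complete_power)
  then have "vwalk_length p \<le> vwalk_length [x, u, y]"
    using p(1) unfolding shortest_vpath_def by (metis last.simps list.sel(1) neq_Nil_conv)
  moreover have "vwalk p ?G" and ends: "hd p = x" "last p = y"
    using p(1) by (auto simp: shortest_vpath_def vpath_def)
  moreover have "2 \<le> vwalk_length p"
    using vwalk_length_ge_distance[OF \<open>vwalk p ?G\<close>] ends dxy ij(2) by simp
  ultimately have "length p = Suc (Suc (Suc 0))" by simp
  then obtain w where pw: "p = [x, w, y]"
    using ends by (auto simp: length_Suc_conv)
  have "card (diff_set r x w) = 1" "card (diff_set r w y) = 1" and w: "w \<in> {1..r} \<rightarrow>\<^sub>E {1..s}"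
    using \<open>vwalk p ?G\<close> unfolding pw vwalk_def by (auto simp: arcs_complete_power)
  then obtain a b where ab: "diff_set r x w = {a}" "diff_set r w y = {b}"
    by (auto simp: card_1_singleton_iff)
  have agree: "w k = x k \<longleftrightarrow> k \<noteq> a" "w k = y k \<longleftrightarrow> k \<noteq> b" if "k \<in> {1..r}" for k
    using ab that unfolding diff_set_def by (auto simp: set_eq_iff)
  \<comment> \<open>The two steps of \<open>p\<close> must change the coordinates \<open>i\<close>
    and \<open>j\<close>, one each. The order of the changes decides whether the middle vertex is
    \<open>u\<close> or \<open>v\<close>.\<close>
  have "diff_set r x y \<subseteq> diff_set r x w \<union> diff_set r w y"
    by (auto simp: diff_set_def)
  then have "{i, j} \<subseteq> {a, b}"
    unfolding dxy ab by blast
  with ij(2) consider "a = i" "b = j" | "a = j" "b = i" by auto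
  then have "w = u \<or> w = v"
  proof cases
    case 1
    have "w = u"
      using 1 ij(2) agree by (intro PiE_ext[OF w V(1)]) (metis x_def y_def fun_upd_apply)
    then show ?thesis ..
  next
    case 2
    have "w k = v k" if "k \<in> {1..r}" for k
    proof -
      have "k \<notin> {i, j} \<Longrightarrow> u k = v k" using ij(1) that unfolding diff_set_def by blast
      then show ?thesis
        using agree[OF that] 2 ij(2) unfolding x_def y_def by (auto split: if_splits)
    qed
    then have "w = v" by (intro PiE_ext[OF w V(2)])
    then show ?thesis ..
  qed
  with uv p(2) pw show False by auto
qed

theorem total_mutual_visibility_set_complete_power_iff:
  "total_mutual_visibility_set (with_proj (complete_power s r)) X \<longleftrightarrow>
     X \<subseteq> {1..r} \<rightarrow>\<^sub>E {1..s} \<and> distance_two_free r X"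
  using distance_two_free_if_total[of s r X] visible_if_distance_two_free[of r X _ s]
  by (auto simp: total_mutual_visibility_set_def)

section \<open>Upper bound for sets without pairs at distance 2\<close>

lemma card_distance_two_free_le:
  fixes X :: "(nat \<Rightarrow> 'a) set"
  assumes "r \<ge> 3" "finite A" and XV: "X \<subseteq> {1..r} \<rightarrow>\<^sub>E A" and free: "distance_two_free r X"
  shows "card X \<le> r * card A ^ (r - 2)"
proof -
  \<comment> \<open>A vertex without neighbours in \<open>X\<close> belongs to every
    \<open>Y i\<close>, so these sets cover \<open>X\<close> but may overlap.\<close>
  define Y where "Y i = {x \<in> X. \<forall>y\<in>X. card (diff_set r x y) \<le> 1 \<longrightarrow> diff_set r x y \<subseteq> {i}}" for i
  have "X \<subseteq> (\<Union>i\<in>{1..r}. Y i)"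
  proof
    fix x assume x: "x \<in> X"
    show "x \<in> (\<Union>i\<in>{1..r}. Y i)"
    proof (cases "\<exists>y\<in>X. card (diff_set r x y) = 1")
      case False
      then have "x \<in> Y 1"
        using x unfolding Y_def by (auto simp: le_Suc_eq)
      then show ?thesis using assms(1) by (intro UN_I[of 1]) auto
    next
      case True
      then obtain y i where y: "y \<in> X" "diff_set r x y = {i}" by (auto simp: card_1_singleton_iff)
      \<comment> \<open>Neighbours of \<open>x\<close> along different coordinates \<open>i\<close>
        and \<open>k\<close> would be at distance 2 from each other.\<close>
      have "diff_set r x z \<subseteq> {i}" if z: "z \<in> X" "card (diff_set r x z) \<le> 1" for z
      proof (rule ccontr)
        assume "\<not> ?thesis"
        moreover from this z(2) have "card (diff_set r x z) = 1"
          by (cases "card (diff_set r x z)") auto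
        ultimately obtain k where k: "diff_set r x z = {k}" "k \<noteq> i"
          by (auto simp: card_1_singleton_iff)
        have "x l = y l \<longleftrightarrow> l \<noteq> i" "x l = z l \<longleftrightarrow> l \<noteq> k" if "l \<in> {1..r}" for l
          using y(2) k(1) that unfolding diff_set_def by blast+
        moreover have "i \<in> {1..r}" "k \<in> {1..r}" using y(2) k(1) unfolding diff_set_def by blast+
        ultimately have "diff_set r y z = {i, k}"
          using k(2) unfolding diff_set_def by fastforce
        with k(2) have "card (diff_set r y z) = 2" by simp
        with free y(1) z(1) show False by (simp add: distance_two_free_def)
      qed
      with x have "x \<in> Y i" by (auto simp: Y_def)
      moreover have "i \<in> {1..r}" using y(2) unfolding diff_set_def by blast
      ultimately show ?thesis by blast
    qed
  qed
  moreover have card_Y: "card (Y i) \<le> card A ^ (r - 2)" if i: "i \<in> {1..r}" for i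
  proof -
    have "card ({1..r} - {i}) = r - 1" using i by simp
    with assms(1) have "2 \<le> card ({1..r} - {i})" by simp
    then obtain T where "T \<subseteq> {1..r} - {i}" "card T = 2"
      by (meson obtain_subset_with_card_n)
    define B where "B = {1..r} - T"
    have B: "finite B" "i \<in> B" "card B = r - 2"
      using \<open>T \<subseteq> _\<close> \<open>card T = 2\<close> i finite_subset[OF \<open>T \<subseteq> _\<close>] card_Diff_subset[of T "{1..r}"]
      unfolding B_def by auto
    \<comment> \<open>Vertices that agree on \<open>B\<close> differ at most in the two coordinates
      of \<open>T\<close>, hence in at most one, as distance 2 is excluded. Membership in
      \<open>Y i\<close> leaves only \<open>i\<close> for it, but \<open>i\<close> lies in
      \<open>B\<close>.\<close>
    have "inj_on (\<lambda>x. restrict x B) (Y i)"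
    proof (rule inj_onI)
      fix x y assume xy: "x \<in> Y i" "y \<in> Y i" "restrict x B = restrict y B"
      then have X: "x \<in> X" "y \<in> X" by (auto simp: Y_def)
      from xy(3) have eq: "x k = y k" if "k \<in> B" for k using that by (metis restrict_apply')
      then have "diff_set r x y \<subseteq> T" unfolding diff_set_def B_def by auto
      then have "card (diff_set r x y) \<le> 2"
        using \<open>card T = 2\<close> by (metis card_mono card.infinite zero_neq_numeral)
      moreover have "card (diff_set r x y) \<noteq> 2" using free X by (simp add: distance_two_free_def)
      ultimately have "diff_set r x y \<subseteq> {i}" using xy(1) X by (simp add: Y_def)
      with eq[OF B(2)] have "diff_set r x y = {}" unfolding diff_set_def by auto
      with X XV show "x = y" using diff_set_eq_empty[of x r A y] by (simp add: subset_iff)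
    qed
    moreover have "(\<lambda>x. restrict x B) ` Y i \<subseteq> B \<rightarrow>\<^sub>E A"
      using XV unfolding Y_def B_def by fastforce
    moreover have "finite (B \<rightarrow>\<^sub>E A)" using B(1) assms(2) by (simp add: finite_PiE)
    ultimately have "card (Y i) \<le> card (B \<rightarrow>\<^sub>E A)" by (rule card_inj_on_le)
    then show ?thesis using B by (simp add: card_PiE)
  qed
  moreover have "finite (Y i)" for i
    unfolding Y_def using finite_subset[OF XV finite_PiE] assms(2) by simp
  ultimately have "card X \<le> card (\<Union>i\<in>{1..r}. Y i)" by (intro card_mono) auto
  also have "\<dots> \<le> (\<Sum>i\<in>{1..r}. card (Y i))" by (rule card_UN_le) simp
  also have "\<dots> \<le> (\<Sum>i\<in>{1..r}. card A ^ (r - 2))" by (intro sum_mono card_Y)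
  finally show ?thesis by simp
qed

section \<open>From bounds on sets to bounds on \<open>mu_t\<close>\<close>

lemma finite_total_mutual_visibility_cards:
  "finite {card X | X. total_mutual_visibility_set (with_proj (complete_power s r)) X}"
proof -
  have "{card X | X. total_mutual_visibility_set (with_proj (complete_power s r)) X}
          \<subseteq> card ` Pow ({1..r} \<rightarrow>\<^sub>E {1..s})"
    by (auto simp: total_mutual_visibility_set_complete_power_iff)
  then show ?thesis by (rule finite_subset) (simp add: finite_PiE)
qed

lemma card_le_mu_t:
  assumes "X \<subseteq> {1..r} \<rightarrow>\<^sub>E {1..s}" "distance_two_free r X"
  shows "card X \<le> mu_t (with_proj (complete_power s r))"
  unfolding mu_t_def using assms
  by (intro Max_ge finite_total_mutual_visibility_cards)
    (auto simp: total_mutual_visibility_set_complete_power_iff)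

lemma mu_t_complete_power_le:
  assumes "r \<ge> 3"
  shows "mu_t (with_proj (complete_power s r)) \<le> r * s ^ (r - 2)"
proof -
  let ?S = "{card X | X. total_mutual_visibility_set (with_proj (complete_power s r)) X}"
  \<comment> \<open>The empty set qualifies even for \<open>s = 0\<close>, so the maximum is over a
    nonempty set.\<close>
  have "card {} \<in> ?S"
    by (intro CollectI exI[of _ "{}"])
      (simp add: total_mutual_visibility_set_complete_power_iff distance_two_free_def)
  then have "?S \<noteq> {}" by blast
  then show ?thesis
    unfolding mu_t_def
    using finite_total_mutual_visibility_cards[of s r] card_distance_two_free_le[OF assms, of "{1..s}"]
    by (subst Max_le_iff) (auto simp: total_mutual_visibility_set_complete_power_iff)
qed

section \<open>Lower bound from two linear invariants\<close>

lemma weighted_sums_separate_distance_two: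
  fixes x y :: "nat \<Rightarrow> nat"
  assumes "card (diff_set r x y) = 2" and sum0: "(\<Sum>k=1..r. x k) = (\<Sum>k=1..r. y k)"
    and sum1: "(\<Sum>k=1..r. k * x k) = (\<Sum>k=1..r. k * y k)"
  shows False
proof -
  obtain i j where ij: "diff_set r x y = {i, j}" "i \<noteq> j" using assms(1) by (auto simp: card_2_iff)
  \<comment> \<open>The differences are taken in the integers because subtraction of naturals
    truncates.\<close>
  define d where "d k = int (x k) - int (y k)" for k
  have supp: "(\<Sum>k=1..r. f k * d k) = f i * d i + f j * d j" for f :: "nat \<Rightarrow> int"
  proof -
    have "(\<Sum>k=1..r. f k * d k) = (\<Sum>k\<in>{i, j}. f k * d k)"
      unfolding ij(1)[symmetric]
      by (intro sum.mono_neutral_right) (auto simp: diff_set_def d_def)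
    then show ?thesis using ij(2) by simp
  qed
  \<comment> \<open>The invariants give two linear equations in \<open>d i\<close> and
    \<open>d j\<close>, with a Vandermonde determinant that is nonzero as \<open>i\<close> and
    \<open>j\<close> are distinct.\<close>
  have "(\<Sum>k=1..r. 1 * d k) = int (\<Sum>k=1..r. x k) - int (\<Sum>k=1..r. y k)"
    by (simp add: d_def sum_subtractf)
  then have 0: "d i + d j = 0" unfolding supp sum0 by simp
  have "(\<Sum>k=1..r. int k * d k) = int (\<Sum>k=1..r. k * x k) - int (\<Sum>k=1..r. k * y k)"
    by (simp add: d_def sum_subtractf right_diff_distrib)
  then have "int i * d i + int j * d j = 0" unfolding supp sum1 by simp
  moreover from 0 have "d j = - d i" by simp
  ultimately have "(int i - int j) * d i = 0" by (simp add: left_diff_distrib)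
  with ij(2) have "x i = y i" by (simp add: d_def)
  with ij(1) show False unfolding diff_set_def by blast
qed

text \<open>Pigeonhole over the fibres of \<open>\<phi>\<close>, each of which has at most
  \<open>mu_t\<close> elements. The constant stands on the right to avoid division of
  naturals.\<close>

lemma le_mu_t_complete_power:
  assumes "r \<ge> 2" "s \<ge> 1"
  shows "s ^ (r - 2) \<le> 4 * r ^ 3 * mu_t (with_proj (complete_power s r))"
proof -
  let ?V = "{1..r} \<rightarrow>\<^sub>E {1..s}" and ?M = "mu_t (with_proj (complete_power s r))"
  let ?C = "{0..r * s} \<times> {0..r * (r * s)}"
  define \<phi> where "\<phi> x = ((\<Sum>k=1..r. x k), (\<Sum>k=1..r. k * x k))" for x :: "nat \<Rightarrow> nat"
  have "\<phi> x \<in> ?C" if x: "x \<in> ?V" for x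
  proof -
    have le: "x k \<le> s" if "k \<in> {1..r}" for k using x that by (auto simp: PiE_iff)
    have "(\<Sum>k=1..r. x k) \<le> r * s"
      using sum_bounded_above[of "{1..r}" x s] le by simp
    moreover have "(\<Sum>k=1..r. k * x k) \<le> r * (r * s)"
      using sum_bounded_above[of "{1..r}" "\<lambda>k. k * x k" "r * s"] le by (simp add: mult_le_mono)
    ultimately show ?thesis by (simp add: \<phi>_def)
  qed
  then have "?V \<subseteq> (\<Union>c\<in>?C. {x \<in> ?V. \<phi> x = c})" by blast
  then have "card ?V \<le> card (\<Union>c\<in>?C. {x \<in> ?V. \<phi> x = c})"
    by (intro card_mono) (auto simp: finite_PiE)
  also have "\<dots> \<le> (\<Sum>c\<in>?C. card {x \<in> ?V. \<phi> x = c})"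
    by (rule card_UN_le) simp
  also have "\<dots> \<le> (\<Sum>c\<in>?C. ?M)"
  proof (intro sum_mono card_le_mu_t)
    fix c
    show "distance_two_free r {x \<in> ?V. \<phi> x = c}"
      unfolding distance_two_free_def
    proof (intro ballI notI)
      fix x y assume "x \<in> {x \<in> ?V. \<phi> x = c}" "y \<in> {x \<in> ?V. \<phi> x = c}" "card (diff_set r x y) = 2"
      moreover from this have "\<phi> x = \<phi> y" by simp
      ultimately show False
        unfolding \<phi>_def using weighted_sums_separate_distance_two by blast
    qed
  qed auto
  finally have "s ^ r \<le> (r * s + 1) * (r * (r * s) + 1) * ?M"
    by (simp add: card_PiE card_cartesian_product)
  \<comment> \<open>Both \<open>r * s\<close> and \<open>r * (r * s)\<close> are at least 1, so each
    added 1 is absorbed by doubling; this yields the constant \<open>4 * r ^ 3\<close>.\<close>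
  also have "\<dots> \<le> (2 * (r * s)) * (2 * (r * (r * s))) * ?M"
    using assms by (intro mult_le_mono1 mult_le_mono) (auto simp: Suc_le_eq)
  also have "\<dots> = s ^ 2 * (4 * r ^ 3 * ?M)"
    by (simp add: power2_eq_square power3_eq_cube)
  also have "s ^ r = s ^ 2 * s ^ (r - 2)"
    using assms(1) by (metis le_add_diff_inverse power_add)
  finally show ?thesis using assms(2) by simp
qed

theorem theorem1p3:
  fixes r :: nat
  assumes "r \<ge> 3"
  shows "(\<lambda>s::nat. real (mu_t (with_proj (complete_power s r)))) \<in> \<Theta>[at_top](\<lambda>s::nat. real s ^ (r - 2))"
proof (rule bigthetaI)
  have "real (mu_t (with_proj (complete_power s r))) \<le> real r * real s ^ (r - 2)" for s
    using of_nat_mono[OF mu_t_complete_power_le[OF assms, of s], where ?'a = real] by simp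
  then show "(\<lambda>s::nat. real (mu_t (with_proj (complete_power s r)))) \<in> O(\<lambda>s. real s ^ (r - 2))"
    by (intro bigoI[where c = "real r"]) simp
next
  have "real s ^ (r - 2) \<le> real (4 * r ^ 3) * real (mu_t (with_proj (complete_power s r)))"
    if "s \<ge> 1" for s
  proof -
    have "real (s ^ (r - 2)) \<le> real (4 * r ^ 3 * mu_t (with_proj (complete_power s r)))"
      using le_mu_t_complete_power[of r s] assms that by (intro of_nat_mono) simp
    then show ?thesis by simp
  qed
  then have "(\<lambda>s::nat. real s ^ (r - 2)) \<in> O(\<lambda>s. real (mu_t (with_proj (complete_power s r))))"
    by (intro bigoI[where c = "real (4 * r ^ 3)"] eventually_mono[OF eventually_ge_at_top[of 1]]) simp
  then show "(\<lambda>s::nat. real (mu_t (with_proj (complete_power s r)))) \<in> \<Omega>(\<lambda>s. real s ^ (r - 2))"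
    by (simp add: bigomega_iff_bigo)
qed

end
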